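(* Let $\theta:\mathbb{N}\to\mathbb{N}$ be an injective map and let $(p_n)_{n\in\mathbb{N}}$ be a sequence in $[1,\infty)$. The operator $S_\theta$ restricts to an isometry on $\ell^{(p_n)}$ if and only if $p_n=p_{\theta(n)}$ for every $n\in\mathbb{N}$.
   Context: Here $\mathbb{N}=\{1,2,3,\dots\}$ and $\mathbb{C}^\infty$ is the space of all complex sequences $a=(a_n)_{n\in\mathbb{N}}$. For a sequence $(p_n)$ in $[1,\infty)$, the variable-exponent space is $\ell^{(p_n)}:=\{a\in\mathbb{C}^\infty : \sum_{n\in\mathbb{N}}|a_n|^{p_n}<\infty\}$, treated as a complex vector space, with norm $\|a\|:=\inf\{\lambda>0 : \sum_{n\in\mathbb{N}}|a_n/\lambda|^{p_n}\le 1\}$. For an injective map $\theta:\mathbb{N}\to\mathbb{N}$, the linear operator $S_\theta:\mathbb{C}^\infty\to\mathbb{C}^\infty$ is defined by $(S_\theta a)_n:=a_{\theta^{-1}(n)}$ if $n\in\theta(\mathbb{N})$, and $(S_\theta a)_n:=0$ otherwise. An isometry is a norm-preserving linear operator, not necessarily surjective; that $S_\theta$ restricts to an isometry on $\ell^{(p_n)}$ means $S_\theta a\in\ell^{(p_n)}$ and $\|S_\theta a\|=\|a\|$ for all $a\in\ell^{(p_n)}$. *)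

theory Defs
  imports Complex_Main "HOL-Library.Extended_Nonnegative_Real"
begin

text \<open>Sequences are indexed by the type \<open>nat\<close>, so the index set starts at 0 instead of 1; the index
  set is only used as a countably infinite set, no arithmetic of indices is involved.\<close>

text \<open>The series is taken in \<open>[0,\<infinity>]\<close>, so that it always has a value and divergence means \<open>\<infinity>\<close>.
  Note that \<open>0 powr r = 0\<close>.\<close>

definition modular :: "(nat \<Rightarrow> real) \<Rightarrow> (nat \<Rightarrow> complex) \<Rightarrow> ennreal" where
  "modular p a = (\<Sum>n. ennreal (cmod (a n) powr p n))"

definition var_lp :: "(nat \<Rightarrow> real) \<Rightarrow> (nat \<Rightarrow> complex) set" where
  "var_lp p = {a. modular p a < \<infinity>}"

text \<open>For exponents in \<open>[1,\<infinity>)\<close> and \<open>a \<in> var_lp p\<close> the set below is nonempty and bounded below,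
  so the real infimum is the intended one.\<close>

definition var_lp_norm :: "(nat \<Rightarrow> real) \<Rightarrow> (nat \<Rightarrow> complex) \<Rightarrow> real" where
  "var_lp_norm p a = Inf {l. l > 0 \<and> modular p (\<lambda>n. a n / of_real l) \<le> 1}"

definition shift_op :: "(nat \<Rightarrow> nat) \<Rightarrow> (nat \<Rightarrow> complex) \<Rightarrow> (nat \<Rightarrow> complex)" where
  "shift_op \<theta> a = (\<lambda>n. if n \<in> range \<theta> then a (inv \<theta> n) else 0)"

lemma shift_op_add: "shift_op \<theta> (\<lambda>n. a n + b n) = (\<lambda>n. shift_op \<theta> a n + shift_op \<theta> b n)"
  by (auto simp: shift_op_def)

lemma shift_op_scale: "shift_op \<theta> (\<lambda>n. c * a n) = (\<lambda>n. c * shift_op \<theta> a n)"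
  by (auto simp: shift_op_def)

text \<open>Linearity is not part of this predicate: it is only applied to \<open>shift_op \<theta>\<close>, which is linear on
  all sequences by the two lemmas above.\<close>

definition restricts_to_isometry ::
    "(nat \<Rightarrow> real) \<Rightarrow> ((nat \<Rightarrow> complex) \<Rightarrow> (nat \<Rightarrow> complex)) \<Rightarrow> bool" where
  "restricts_to_isometry p T \<longleftrightarrow>
     (\<forall>a \<in> var_lp p. T a \<in> var_lp p \<and> var_lp_norm p (T a) = var_lp_norm p a)"

end

theory Submission
  imports Defs "HOL-Analysis.Nonnegative_Lebesgue_Integration" "HOL-Real_Asymp.Real_Asymp"
begin

text \<open>Reindexing the series along \<open>\<theta>\<close> shows that the norm of \<open>shift_op \<theta> a\<close> for \<open>p\<close> is the norm of
  \<open>a\<close> for the exponents \<open>p \<circ> \<theta>\<close>, which settles one direction. Conversely, for sequences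
  supported on a two-point set \<open>{m, n}\<close> the norm is 1 exactly if the modular is 1, so an isometry yields
  \<open>t powr \<alpha> + (1 - t) powr \<beta> = 1\<close> for \<open>0 < t < 1\<close>, where \<open>\<alpha> = p (\<theta> n) / p n\<close> and
  \<open>\<beta> = p (\<theta> m) / p m\<close>. Hence \<open>t powr \<alpha> / t\<close> tends to \<open>\<beta>\<close>, a positive number, as \<open>t\<close> tends to 0,
  and this forces \<open>\<alpha> = 1\<close>.\<close>

text \<open>Since exponents are at least 1, each term grows at least by the factor \<open>l\<close>.
  Together with the upper bound below, this shows how far rescaling moves the modular.\<close>

lemma modular_scale_ge:
  assumes "\<And>n. 1 \<le> p n" and "1 \<le> l"
  shows "ennreal l * modular p a \<le> modular p (\<lambda>n. of_real l * a n)"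
proof -
  have "l * cmod (a n) powr p n \<le> cmod (of_real l * a n) powr p n" for n
  proof -
    have "l powr 1 \<le> l powr p n"
      using assms by (intro powr_mono) auto
    then show ?thesis
      using assms(2) by (auto simp: norm_mult powr_mult intro!: mult_right_mono)
  qed
  then show ?thesis
    using assms(2) unfolding modular_def ennreal_suminf_cmult[symmetric]
    by (intro suminf_le) (auto simp: ennreal_mult[symmetric] ennreal_leI)
qed

lemma modular_scale_le:
  assumes "1 \<le> l" and "\<And>n. a n \<noteq> 0 \<Longrightarrow> p n \<le> M"
  shows "modular p (\<lambda>n. of_real l * a n) \<le> ennreal (l powr M) * modular p a"
proof -
  have "cmod (of_real l * a n) powr p n \<le> l powr M * cmod (a n) powr p n" for n
  proof (cases "a n = 0")
    case False
    then have "l powr p n \<le> l powr M"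
      using assms by (intro powr_mono) auto
    then show ?thesis
      using assms(1) by (auto simp: norm_mult powr_mult intro!: mult_right_mono)
  qed auto
  then show ?thesis
    unfolding modular_def ennreal_suminf_cmult[symmetric]
    by (intro suminf_le) (auto simp: ennreal_mult[symmetric] ennreal_leI)
qed

text \<open>The bound \<open>M\<close> on the exponents over the support makes the modular respond
  continuously to scaling. For unbounded exponents a modular below 1 can go with norm 1, because
  every enlargement may diverge.\<close>

lemma var_lp_norm_eq_1_iff:
  assumes p: "\<And>n. 1 \<le> p n" and a: "a \<in> var_lp p"
    and M: "\<And>n. a n \<noteq> 0 \<Longrightarrow> p n \<le> M" "0 < M"
  shows "var_lp_norm p a = 1 \<longleftrightarrow> modular p a = 1"
proof -
  define L where "L = {l. l > 0 \<and> modular p (\<lambda>n. a n / of_real l) \<le> 1}"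
  have norm_eq: "var_lp_norm p a = Inf L"
    by (simp add: var_lp_norm_def L_def)
  have bdd: "bdd_below L"
    by (rule bdd_belowI[of _ 0]) (auto simp: L_def)
  obtain c where c: "modular p a = ennreal c" "0 \<le> c"
    using a by (cases "modular p a") (auto simp: var_lp_def)
  \<comment> \<open>Dividing by some \<open>l < 1\<close> multiplies the modular by at least
    \<open>1 / l\<close>, which pushes it above 1.\<close>
  have L_ge_1: "1 \<le> l" if "l \<in> L" "1 \<le> c" for l
  proof (rule ccontr)
    assume "\<not> 1 \<le> l"
    with that have l: "0 < l" "l < 1"
      by (auto simp: L_def)
    have "ennreal (1 / l) * modular p a \<le> modular p (\<lambda>n. of_real (1 / l) * a n)"
      using l by (intro modular_scale_ge p) auto
    also have "\<dots> = modular p (\<lambda>n. a n / of_real l)"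
      by (simp add: field_simps)
    also have "\<dots> \<le> 1"
      using that by (simp add: L_def)
    finally have "c / l \<le> 1"
      using l c by (simp add: ennreal_mult[symmetric])
    with l that(2) show False
      by (simp add: field_simps)
  qed
  consider "c < 1" | "c = 1" | "c > 1" by linarith
  then show ?thesis
  proof cases
    case 1
    \<comment> \<open>The maximum keeps \<open>d\<close>, and so \<open>l\<close>, positive even if
      \<open>c = 0\<close>. As \<open>l powr M = d\<close>, dividing by \<open>l\<close> multiplies
      the modular by at most \<open>1 / d\<close>, leaving it at most 1.\<close>
    define d where "d = max c (1/2)"
    define l where "l = d powr (1 / M)"
    have d: "0 < d" "d < 1" "c \<le> d"
      using 1 by (auto simp: d_def)
    have l: "0 < l" "l < 1" "(1 / l) powr M = 1 / d"
      using d M(2) powr_less_mono2[of "1 / M" d 1] by (auto simp: l_def powr_powr powr_divide)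
    have "modular p (\<lambda>n. a n / of_real l) = modular p (\<lambda>n. of_real (1 / l) * a n)"
      by (simp add: field_simps)
    also have "\<dots> \<le> ennreal ((1 / l) powr M) * modular p a"
      using l by (intro modular_scale_le M) auto
    also have "\<dots> = ennreal (c / d)"
      using d c(2) by (simp add: l(3) c(1) ennreal_mult[symmetric])
    also have "\<dots> \<le> 1"
      using d c(2) by (auto intro: ennreal_le_1[THEN iffD2])
    finally have "l \<in> L"
      using l by (simp add: L_def)
    then have "var_lp_norm p a \<le> l"
      unfolding norm_eq by (intro cInf_lower bdd)
    then show ?thesis
      using l 1 c by auto
  next
    case 2
    have "1 \<in> L"
      using 2 c by (simp add: L_def)
    moreover have "1 \<le> l" if "l \<in> L" for l
      using L_ge_1[OF that] 2 by simp
    ultimately have "Inf L = 1"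
      by (intro cInf_eq_minimum)
    then show ?thesis
      using 2 c by (simp add: norm_eq)
  next
    case 3
    have unscale: "modular p a = modular p (\<lambda>n. of_real l * (a n / of_real l))" if "0 < l" for l
      using that by simp
    \<comment> \<open>Dividing by \<open>c\<close> itself brings the modular down to at most 1. So
      \<open>L\<close> is nonempty, and a lower bound of \<open>L\<close> above 1 also bounds its
      infimum.\<close>
    have "ennreal c * modular p (\<lambda>n. a n / of_real c) \<le> ennreal c * 1"
      using modular_scale_ge[of p c "\<lambda>n. a n / of_real c", OF p] 3 unscale[of c] c(1) by simp
    then have "modular p (\<lambda>n. a n / of_real c) \<le> 1"
      using 3 by (subst (asm) ennreal_mult_le_mult_iff) auto
    then have nonempty: "L \<noteq> {}"
      using 3 by (auto simp: L_def intro!: exI[of _ c])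
    have "c powr (1 / M) \<le> l" if "l \<in> L" for l
    proof -
      have l: "0 < l" "modular p (\<lambda>n. a n / of_real l) \<le> 1"
        using that by (auto simp: L_def)
      have "1 \<le> l"
        using L_ge_1[OF that] 3 by simp
      then have "ennreal c \<le> ennreal (l powr M) * modular p (\<lambda>n. a n / of_real l)"
        unfolding c(1)[symmetric] unscale[OF l(1)]
        by (intro modular_scale_le M) auto
      also have "\<dots> \<le> ennreal (l powr M) * 1"
        by (intro mult_left_mono l) auto
      finally have "c \<le> l powr M"
        by simp
      then have "c powr (1 / M) \<le> (l powr M) powr (1 / M)"
        using c M by (intro powr_mono2) auto
      then show ?thesis
        using l M by (simp add: powr_powr)
    qed
    then have "c powr (1 / M) \<le> var_lp_norm p a"
      unfolding norm_eq by (intro cInf_greatest nonempty)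
    moreover have "1 < c powr (1 / M)"
      using 3 M by simp
    ultimately show ?thesis
      using 3 c by auto
  qed
qed

text \<open>Entries outside \<open>range \<theta>\<close> vanish and contribute
  \<open>0 powr p n = 0\<close>, so only the indices \<open>\<theta> n\<close> matter.\<close>

lemma modular_shift_op:
  assumes "inj \<theta>"
  shows "modular p (shift_op \<theta> a) = modular (p \<circ> \<theta>) a"
proof -
  let ?f = "\<lambda>n. ennreal (cmod (shift_op \<theta> a n) powr p n)"
  have "modular p (shift_op \<theta> a) = (\<integral>\<^sup>+n. ?f n \<partial>count_space UNIV)"
    by (simp add: modular_def nn_integral_count_space_nat)
  also have "\<dots> = (\<integral>\<^sup>+n. ?f n \<partial>count_space (range \<theta>))"
    by (rule nn_integral_count_space_eq) (auto simp: shift_op_def)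
  also have "\<dots> = (\<integral>\<^sup>+n. ?f (\<theta> n) \<partial>count_space UNIV)"
    by (rule nn_integral_bij_count_space[symmetric]) (simp add: assms bij_betw_def)
  also have "\<dots> = modular (p \<circ> \<theta>) a"
    using assms by (simp add: modular_def shift_op_def nn_integral_count_space_nat)
  finally show ?thesis .
qed

lemma var_lp_norm_shift_op:
  assumes "inj \<theta>"
  shows "var_lp_norm p (shift_op \<theta> a) = var_lp_norm (p \<circ> \<theta>) a"
proof -
  have "(\<lambda>n. shift_op \<theta> a n / of_real l) = shift_op \<theta> (\<lambda>n. a n / of_real l)" for l
    by (auto simp: shift_op_def)
  then show ?thesis
    by (simp add: var_lp_norm_def modular_shift_op[OF assms])
qed

lemma modular_two_point:
  assumes "m \<noteq> n" and "0 \<le> x" and "0 \<le> y"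
  shows "modular p ((\<lambda>_. 0)(n := of_real x, m := of_real y)) = ennreal (x powr p n + y powr p m)"
proof -
  have "modular p ((\<lambda>_. 0)(n := of_real x, m := of_real y)) =
      (\<Sum>k\<in>{n, m}. ennreal (cmod (((\<lambda>_. 0)(n := of_real x, m := of_real y)) k) powr p k))"
    unfolding modular_def by (rule suminf_finite) auto
  then show ?thesis
    using assms by simp
qed

lemma powr_add_powr_eq_1_imp:
  fixes \<alpha> \<beta> :: real
  assumes "0 < \<beta>" and eq: "\<And>t. 0 < t \<Longrightarrow> t < 1 \<Longrightarrow> t powr \<alpha> + (1 - t) powr \<beta> = 1"
  shows "\<alpha> = 1"
proof -
  \<comment> \<open>This is minus the derivative of \<open>(1 - t) powr \<beta>\<close> at
    0.\<close>
  have "((\<lambda>t. (1 - (1 - t) powr \<beta>) / t) \<longlongrightarrow> \<beta>) (at_right 0)"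
    by real_asymp
  moreover have "\<forall>\<^sub>F t in at_right 0. (1 - (1 - t) powr \<beta>) / t = t powr (\<alpha> - 1)"
    using eventually_at_right_real[of 0 "1::real", OF zero_less_one]
  proof eventually_elim
    case (elim t)
    then show ?case
      using eq[of t] by (simp add: powr_diff)
  qed
  ultimately have lim: "((\<lambda>t. t powr (\<alpha> - 1)) \<longlongrightarrow> \<beta>) (at_right 0)"
    by (rule Lim_transform_eventually)
  show ?thesis
  proof (rule ccontr)
    assume "\<alpha> \<noteq> 1"
    \<comment> \<open>A power with nonzero exponent tends to 0 or to infinity, never to the positive
      real \<beta>.\<close>
    then consider "\<alpha> - 1 > 0" | "\<alpha> - 1 < 0" by linarith
    then show False
    proof cases
      case 1
      then have "((\<lambda>t. t powr (\<alpha> - 1)) \<longlongrightarrow> 0) (at_right 0)"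
        by real_asymp
      then show False
        using tendsto_unique[OF _ lim] assms(1) by fastforce
    next
      case 2
      then have "filterlim (\<lambda>t. t powr (\<alpha> - 1)) at_top (at_right 0)"
        by real_asymp
      then show False
        using not_tendsto_and_filterlim_at_infinity[OF trivial_limit_at_right_real lim]
          filterlim_at_top_imp_at_infinity by blast
    qed
  qed
qed

theorem theorem1p7:
  fixes \<theta> :: "nat \<Rightarrow> nat" and p :: "nat \<Rightarrow> real"
  assumes "inj \<theta>" and "\<And>n. 1 \<le> p n"
  shows "restricts_to_isometry p (shift_op \<theta>) \<longleftrightarrow> (\<forall>n. p n = p (\<theta> n))"
proof
  assume "\<forall>n. p n = p (\<theta> n)"
  then have "p \<circ> \<theta> = p" by auto
  then show "restricts_to_isometry p (shift_op \<theta>)"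
    by (simp add: restricts_to_isometry_def var_lp_def modular_shift_op var_lp_norm_shift_op
        assms(1))
next
  assume iso: "restricts_to_isometry p (shift_op \<theta>)"
  show "\<forall>n. p n = p (\<theta> n)"
  proof
    fix n
    have pos: "p k > 0" for k
      using assms(2)[of k] by linarith
    \<comment> \<open>Any index other than \<open>n\<close> would do.\<close>
    define m where "m = Suc n"
    have "p (\<theta> n) / p n = 1"
    proof (rule powr_add_powr_eq_1_imp)
      show "0 < p (\<theta> m) / p m"
        using pos by simp
      fix t :: real
      assume t: "0 < t" "t < 1"
      \<comment> \<open>The entries are normalised so that the modular for \<open>p\<close> is
        \<open>t + (1 - t) = 1\<close>.\<close>
      define a :: "nat \<Rightarrow> complex" where
        "a = (\<lambda>_. 0)(n := of_real (t powr (1 / p n)), m := of_real ((1 - t) powr (1 / p m)))"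
      have modular_a: "modular q a = ennreal (t powr (q n / p n) + (1 - t) powr (q m / p m))" for q
        unfolding a_def by (subst modular_two_point) (auto simp: m_def powr_powr)
      \<comment> \<open>Stated for general \<open>q\<close> to serve both \<open>p\<close> and
        \<open>p \<circ> \<theta>\<close>; on the two-point support the larger exponent is the
        bound.\<close>
      have norm_1_iff: "var_lp_norm q a = 1 \<longleftrightarrow> modular q a = 1" if "\<And>k. 1 \<le> q k" for q
      proof (rule var_lp_norm_eq_1_iff[OF that])
        show "a \<in> var_lp q"
          by (simp add: var_lp_def modular_a)
        show "q k \<le> max (q n) (q m)" if "a k \<noteq> 0" for k
          using that by (auto simp: a_def split: if_splits)
        show "0 < max (q n) (q m)"
          using that[of n] by auto
      qed
      have "modular p a = 1"
        using t pos[of n] pos[of m] by (simp add: modular_a)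
      then have "a \<in> var_lp p" "var_lp_norm p a = 1"
        using norm_1_iff[OF assms(2)] by (auto simp: var_lp_def)
      then have "var_lp_norm (p \<circ> \<theta>) a = 1"
        using iso by (simp add: restricts_to_isometry_def var_lp_norm_shift_op assms(1))
      then have "modular (p \<circ> \<theta>) a = 1"
        using norm_1_iff[of "p \<circ> \<theta>"] assms(2) by simp
      then show "t powr (p (\<theta> n) / p n) + (1 - t) powr (p (\<theta> m) / p m) = 1"
        by (simp add: modular_a del: ennreal_plus)
    qed
    then show "p n = p (\<theta> n)"
      using pos[of n] by simp
  qed
qed

end
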